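(* There exists a function $\nu:\mathbb{N}\to(0,+\infty)$ such that for every positive integer $n$, every integral polyhedron $P\subseteq\mathbb{R}^n$ whose interior contains an integer point contains a centrally symmetric convex body of volume $\nu(n)$ whose only integer point is its center.
   Context: A polyhedron $P$ is integral if $P=\operatorname{conv}(P\cap\mathbb{Z}^n)$. A convex body is a closed, convex, bounded subset of $\mathbb{R}^n$ with nonempty interior. A set $C$ is centrally symmetric with respect to $x\in C$ (its center) if for every $y\in\mathbb{R}^n$, $x+y\in C$ iff $x-y\in C$. Volume is $n$-dimensional Lebesgue measure. *)

theory Defs
  imports "HOL-Analysis.Analysis"
begin

definition int_points :: "(real^'n) set" where
  "int_points = {x. \<forall>i. x $ i \<in> \<int>}"

definition integral_polyhedron :: "(real^'n) set \<Rightarrow> bool" where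
  "integral_polyhedron P \<longleftrightarrow> polyhedron P \<and> P = convex hull (P \<inter> int_points)"

definition convex_body :: "(real^'n) set \<Rightarrow> bool" where
  "convex_body C \<longleftrightarrow> closed C \<and> convex C \<and> bounded C \<and> interior C \<noteq> {}"

definition centrally_symmetric_wrt :: "(real^'n) set \<Rightarrow> real^'n \<Rightarrow> bool" where
  "centrally_symmetric_wrt C x \<longleftrightarrow> x \<in> C \<and> (\<forall>y. x + y \<in> C \<longleftrightarrow> x - y \<in> C)"

end

theory Submission
  imports Defs
begin

text \<open>Write an interior integer point of \<open>P\<close> as a positive convex combination
  \<open>\<Sum>i. a\<^sub>i v\<^sub>i\<close> of a bounded number of affinely spanning integer points of \<open>P\<close>. Every
  \<open>c\<close> with \<open>c\<^sub>i \<equiv> k a\<^sub>i (mod 1)\<close> for some fixed \<open>k\<close>, \<open>c \<ge> 0\<close> and \<open>\<Sum>i. c\<^sub>i = 1\<close> gives another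
  integer point \<open>x = \<Sum>i. c\<^sub>i v\<^sub>i\<close> of \<open>P\<close>. A uniform Kronecker theorem yields such a \<open>c\<close> whose
  entries are all at least some \<open>\<delta>\<close> that depends only on the number of points:
  either \<open>a\<close> has no short integer relation beyond those of a fixed positive vector \<open>b\<close>, and
  then multiples of \<open>a\<close> come close to \<open>b\<close>, or \<open>a\<close> lies in one of finitely many smaller
  subspaces. Hence \<open>x \<plusminus> \<delta> (v\<^sub>i - x) \<in> P\<close>, and \<open>n\<close> of the vectors \<open>v\<^sub>i - x\<close> are independent. The
  cross polytope that they span around \<open>x\<close> may contain further lattice points, but
  exchanging such a point for a vector decreases the determinant, so this process stops. The
  final cross polytope has volume at least \<open>(\<delta> / n) ^ n\<close>, since a dilate by \<open>n / \<delta>\<close>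
  contains a fundamental cell of a sublattice of the integer lattice; finally it is shrunk.\<close>

section \<open>A uniform Kronecker theorem\<close>

text \<open>Since \<open>(1 + cos x) / 2\<close> equals
  \<open>cis (- x) * (cis x + 1)\<^sup>2 / 4\<close>, the binomial theorem yields the Fourier
  expansion. All coefficients are nonnegative, and the constant one, at \<open>j = L\<close>, is the
  central binomial coefficient over \<open>4 ^ L\<close>.\<close>

lemma cos_kernel_expand:
  "complex_of_real (((1 + cos (2 * pi * t)) / 2) ^ L) =
     (\<Sum>j\<le>2*L. of_real (real (2 * L choose j) / 4 ^ L) * cis (2 * pi * ((real j - real L) * t)))"
proof -
  define x where "x = 2 * pi * t"
  have "complex_of_real ((1 + cos x) / 2) = cis (- x) * (cis x + 1)\<^sup>2 / 4"
  proof -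
    have "cis (- x) * (cis x + 1)\<^sup>2 = cis (- x + x) * cis x + 2 * cis (- x + x) + cis (- x)"
      unfolding cis_mult[symmetric] by algebra
    also have "\<dots> = 2 + (cis x + cis (- x))" by simp
    also have "cis x + cis (- x) = 2 * complex_of_real (cos x)"
      by (simp add: complex_eq_iff)
    finally show ?thesis by (simp add: field_simps)
  qed
  hence "complex_of_real (((1 + cos x) / 2) ^ L) = cis (- x) ^ L * (cis x + 1) ^ (2 * L) / 4 ^ L"
    unfolding of_real_power by (metis power_mult power_divide power_mult_distrib)
  also have "(cis x + 1) ^ (2 * L) = (\<Sum>j\<le>2*L. of_nat (2 * L choose j) * cis (real j * x))"
    by (subst binomial_ring) (simp add: Complex.DeMoivre)
  also have "cis (- x) ^ L * (\<Sum>j\<le>2*L. of_nat (2 * L choose j) * cis (real j * x)) / 4 ^ L =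
     (\<Sum>j\<le>2*L. of_real (real (2 * L choose j) / 4 ^ L) * cis ((real j - real L) * x))"
    unfolding sum_distrib_left sum_divide_distrib
    by (intro sum.cong refl) (simp add: Complex.DeMoivre cis_mult algebra_simps)
  finally show ?thesis
    by (simp add: x_def mult_ac)
qed

section \<open>Exponential sums and decay of the kernel\<close>

lemma cis_eq_1_imp_Ints: "cis (2 * pi * t) = 1 \<Longrightarrow> t \<in> \<int>"
proof -
  assume "cis (2 * pi * t) = 1"
  hence "cos (2 * pi * t) = 1" by (metis cis.sel(1) one_complex.sel(1))
  then obtain k :: int where "2 * pi * t = of_int k * 2 * pi" using cos_one_2pi_int by blast
  thus "t \<in> \<int>" by simp
qed

text \<open>For integer \<open>\<alpha>\<close> every term is 1; otherwise the sum is geometric with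
  ratio \<open>w \<noteq> 1\<close> and has modulus at most \<open>2 / cmod (w - 1)\<close>. The
  bound may depend on \<open>\<alpha>\<close>, but not on the number \<open>K\<close> of
  terms.\<close>

lemma exponential_sum_bounded_below:
  assumes "\<alpha> \<in> \<int> \<longrightarrow> \<beta> \<in> \<int>"
  shows "\<exists>B. \<forall>K. - B \<le> Re (\<Sum>k<K. cis (2 * pi * (real k * \<alpha> - \<beta>)))"
proof (cases "\<alpha> \<in> \<int>")
  case True
  have "cis (2 * pi * (real k * \<alpha> - \<beta>)) = 1" for k
    using True assms by (intro cis_multiple_2pi) auto
  thus ?thesis by (intro exI[of _ 0]) simp
next
  case False
  define w where "w = cis (2 * pi * \<alpha>)"
  have w: "w \<noteq> 1" using False cis_eq_1_imp_Ints unfolding w_def by blast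
  have "- (2 / cmod (w - 1)) \<le> Re (\<Sum>k<K. cis (2 * pi * (real k * \<alpha> - \<beta>)))" for K
  proof -
    have "(\<Sum>k<K. cis (2 * pi * (real k * \<alpha> - \<beta>))) = cis (- 2 * pi * \<beta>) * (\<Sum>k<K. w ^ k)"
      unfolding sum_distrib_left w_def
    proof (intro sum.cong refl)
      fix k
      have "2 * pi * (real k * \<alpha> - \<beta>) = - 2 * pi * \<beta> + real k * (2 * pi * \<alpha>)"
        by (simp add: algebra_simps)
      thus "cis (2 * pi * (real k * \<alpha> - \<beta>)) = cis (- 2 * pi * \<beta>) * cis (2 * pi * \<alpha>) ^ k"
        by (metis Complex.DeMoivre cis_mult)
    qed
    also have "\<dots> = cis (- 2 * pi * \<beta>) * ((w ^ K - 1) / (w - 1))"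
      using w by (simp add: geometric_sum)
    finally have "cmod (\<Sum>k<K. cis (2 * pi * (real k * \<alpha> - \<beta>))) = cmod (w ^ K - 1) / cmod (w - 1)"
      by (simp add: norm_mult norm_divide)
    also have "cmod (w ^ K - 1) \<le> cmod (w ^ K) + 1"
      by (metis norm_one norm_triangle_ineq4)
    also have "\<dots> = 2" by (simp add: w_def norm_power)
    finally have "cmod (\<Sum>k<K. cis (2 * pi * (real k * \<alpha> - \<beta>))) \<le> 2 / cmod (w - 1)"
      by (simp add: divide_right_mono)
    thus ?thesis using abs_Re_le_cmod[of "\<Sum>k<K. cis (2 * pi * (real k * \<alpha> - \<beta>))"] by linarith
  qed
  thus ?thesis by blast
qed

lemma cis_sum: "finite A \<Longrightarrow> (\<Prod>i\<in>A. cis (f i)) = cis (\<Sum>i\<in>A. f i)"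
  by (induction A rule: finite_induct) (auto simp: cis_mult)

text \<open>Isolates the constant Fourier term: with nonnegative weights, the other frequencies can
  lower the sum only by an amount independent of \<open>K\<close>.\<close>

lemma sum_ge_single_minus:
  fixes h :: "'j \<Rightarrow> real"
  assumes "finite S" "s \<in> S" "\<And>j. j \<in> S \<Longrightarrow> h j \<ge> 0"
    and "\<And>j. j \<in> S \<Longrightarrow> \<exists>B. \<forall>K::nat. - B \<le> T j K"
  shows "\<exists>B. \<forall>K. h s * T s K - B \<le> (\<Sum>j\<in>S. h j * T j K)"
proof -
  obtain B where B: "\<And>j K. j \<in> S \<Longrightarrow> - B j \<le> T j K" using assms(4) by metis
  have "h s * T s K - (\<Sum>j\<in>S-{s}. h j * B j) \<le> (\<Sum>j\<in>S. h j * T j K)" for K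
  proof -
    have "(\<Sum>j\<in>S-{s}. h j * - B j) \<le> (\<Sum>j\<in>S-{s}. h j * T j K)"
      using B assms(3) by (intro sum_mono mult_left_mono) auto
    thus ?thesis using assms(1,2) by (simp add: sum.remove sum_negf)
  qed
  thus ?thesis by blast
qed

lemma cos_le_if_far_from_round:
  assumes "0 < \<epsilon>" "\<epsilon> \<le> 1/2" "\<bar>t - of_int (round t)\<bar> \<ge> \<epsilon>"
  shows "cos (2 * pi * t) \<le> cos (2 * pi * \<epsilon>)"
proof -
  define d where "d = \<bar>t - of_int (round t)\<bar>"
  have d: "d \<le> 1/2" using of_int_round_abs_le[of t] by (simp add: d_def abs_minus_commute)
  have "cos (2 * pi * t) = cos (2 * pi * (t - of_int (round t)) + 2 * pi * of_int (round t))"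
    by (simp add: algebra_simps)
  also have "\<dots> = cos (2 * pi * (t - of_int (round t)))"
    by (simp add: cos_add cos_int_2pin sin_int_2pin)
  also have "\<dots> = cos \<bar>2 * pi * (t - of_int (round t))\<bar>" by simp
  also have "\<bar>2 * pi * (t - of_int (round t))\<bar> = 2 * pi * d"
    by (simp add: d_def abs_mult)
  also have "cos (2 * pi * d) \<le> cos (2 * pi * \<epsilon>)"
    using assms d by (intro cos_monotone_0_pi_le) (auto simp: d_def)
  finally show ?thesis .
qed

text \<open>The central binomial coefficient over \<open>4 ^ L\<close> is at least
  \<open>1 / (2 * L)\<close>, and exponential decay beats this. Taking the \<open>m\<close>-th root
  of \<open>q\<close> first removes the outer power.\<close>

lemma power_less_central_binomial_power:
  fixes q :: real
  assumes "0 \<le> q" "q < 1" "0 < m"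
  shows "\<exists>L. q ^ L < (real (2 * L choose L) / 4 ^ L) ^ m"
proof -
  define r where "r = root m q"
  have r: "0 \<le> r" "r < 1" "r ^ m = q" using assms by (auto simp: r_def)
  have "(\<lambda>L. real L * r ^ L) \<longlonglongrightarrow> 0"
    using powser_times_n_limit_0[of r] r by simp
  hence "\<forall>\<^sub>F L in sequentially. real L * r ^ L < 1/2"
    by (rule order_tendstoD) simp
  hence "\<forall>\<^sub>F L in sequentially. 0 < L \<and> real L * r ^ L < 1/2"
    using eventually_gt_at_top[of 0] by eventually_elim simp
  then obtain L where L: "0 < L" "real L * r ^ L < 1/2"
    by (auto dest: eventually_happens)
  have "r ^ L < 1 / (2 * real L)" using L by (simp add: field_simps)
  also have "\<dots> \<le> real (2 * L choose L) / 4 ^ L"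
    using central_binomial_lower_bound[of L] L by (simp add: field_simps)
  finally have "(r ^ L) ^ m < (real (2 * L choose L) / 4 ^ L) ^ m"
    using r assms by (intro power_strict_mono) auto
  moreover have "(r ^ L) ^ m = q ^ L" using r by (metis power_mult mult.commute)
  ultimately show ?thesis by auto
qed

lemma half_one_plus_cos: "0 \<le> (1 + cos x) / 2" "(1 + cos x) / 2 \<le> 1" for x :: real
  using cos_ge_minus_one[of x] cos_le_one[of x] by (simp, linarith) simp

text \<open>Kronecker's theorem with a uniform bound on the relations to be checked: the average
  over \<open>k\<close> of the nonnegative trigonometric polynomial
  \<open>\<Prod>i. ((1 + cos (2 \<pi> (k a\<^sub>i - b\<^sub>i))) / 2) ^ L\<close> is at least its constant coefficient, which is
  polynomially small in \<open>L\<close>, while its values are exponentially small away from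
  the lattice.\<close>

lemma kronecker_uniform:
  assumes "0 < (\<epsilon>::real)"
  shows "\<exists>N::nat. \<forall>a b :: real^'m.
    (\<forall>c. (\<forall>i. c $ i \<in> \<int> \<and> \<bar>c $ i\<bar> \<le> real N) \<and> c \<bullet> a \<in> \<int> \<longrightarrow> c \<bullet> b \<in> \<int>) \<longrightarrow>
    (\<exists>k::nat. \<exists>z. (\<forall>i. z $ i \<in> \<int>) \<and> (\<forall>i. \<bar>real k * a $ i + z $ i - b $ i\<bar> < \<epsilon>))"
proof -
  \<comment> \<open>The cap 1/2 keeps \<open>2 * pi * e\<close> in \<open>[0, pi]\<close>, where
    \<open>cos\<close> decreases.\<close>
  define e where "e = min \<epsilon> (1/2)"
  have e: "0 < e" "e \<le> 1/2" "e \<le> \<epsilon>" using assms by (auto simp: e_def)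
  define q where "q = (1 + cos (2 * pi * e)) / 2"
  have "cos (2 * pi * e) < cos 0" using e by (intro cos_monotone_0_pi) auto
  hence q: "0 \<le> q" "q < 1" by (simp_all add: q_def) (smt (verit) cos_ge_minus_one)
  define m where "m = CARD('m)"
  have "0 < m" by (simp add: m_def)
  then obtain L where L: "q ^ L < (real (2 * L choose L) / 4 ^ L) ^ m"
    using power_less_central_binomial_power q by blast
  define g where "g j = real (2 * L choose j) / 4 ^ L" for j
  define F where "F \<theta> = (\<Prod>i\<in>UNIV. ((1 + cos (2 * pi * (\<theta> $ i))) / 2) ^ L)" for \<theta> :: "real^'m"
  define S where "S = (UNIV :: 'm set) \<rightarrow>\<^sub>E {..2 * L}"
  define h where "h J = (\<Prod>i\<in>UNIV. g (J i))" for J :: "'m \<Rightarrow> nat"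
  \<comment> \<open>The frequency belonging to \<open>J\<close>. For \<open>J \<in> S\<close> its
    entries are integers between \<open>-L\<close> and \<open>L\<close>, so \<open>L\<close> also
    serves as the bound on the relations to be checked.\<close>
  define c where "c J = (\<chi> i. real (J i) - real L)" for J :: "'m \<Rightarrow> nat"
  have F_expand: "complex_of_real (F \<theta>) = (\<Sum>J\<in>S. of_real (h J) * cis (2 * pi * (c J \<bullet> \<theta>)))" for \<theta>
  proof -
    have "complex_of_real (F \<theta>) =
      (\<Prod>i\<in>UNIV. \<Sum>j\<le>2*L. of_real (g j) * cis (2 * pi * ((real j - real L) * \<theta> $ i)))"
      unfolding F_def of_real_prod cos_kernel_expand g_def ..
    also have "\<dots> = (\<Sum>J\<in>S. \<Prod>i\<in>UNIV. of_real (g (J i)) * cis (2 * pi * ((real (J i) - real L) * \<theta> $ i)))"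
      unfolding S_def by (rule prod_sum_PiE) auto
    also have "\<dots> = (\<Sum>J\<in>S. of_real (h J) * cis (2 * pi * (c J \<bullet> \<theta>)))"
      by (intro sum.cong refl)
         (simp add: prod.distrib cis_sum h_def c_def inner_vec_def sum_distrib_left)
    finally show ?thesis .
  qed
  show ?thesis
  proof (rule exI[of _ L], intro allI impI)
    fix a b :: "real^'m"
    assume rel: "\<forall>c. (\<forall>i. c $ i \<in> \<int> \<and> \<bar>c $ i\<bar> \<le> real L) \<and> c \<bullet> a \<in> \<int> \<longrightarrow> c \<bullet> b \<in> \<int>"
    define T where "T J K = Re (\<Sum>k<K. cis (2 * pi * (real k * (c J \<bullet> a) - c J \<bullet> b)))" for J K
    \<comment> \<open>The index of frequency 0, whose exponential sum is exactly
      \<open>K\<close>.\<close>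
    define J0 :: "'m \<Rightarrow> nat" where "J0 = (\<lambda>_. L)"
    have sum_F: "(\<Sum>k<K. F (real k *\<^sub>R a - b)) = (\<Sum>J\<in>S. h J * T J K)" for K
    proof -
      have "(\<Sum>k<K. F (real k *\<^sub>R a - b)) = Re (\<Sum>k<K. of_real (F (real k *\<^sub>R a - b)))"
        by simp
      also have "(\<Sum>k<K. complex_of_real (F (real k *\<^sub>R a - b))) =
          (\<Sum>J\<in>S. of_real (h J) * (\<Sum>k<K. cis (2 * pi * (real k * (c J \<bullet> a) - c J \<bullet> b))))"
        unfolding F_expand by (subst sum.swap) (simp add: sum_distrib_left inner_diff_right)
      finally show ?thesis by (simp add: T_def)
    qed
    have "\<exists>B. \<forall>K. h J0 * T J0 K - B \<le> (\<Sum>J\<in>S. h J * T J K)"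
    proof (rule sum_ge_single_minus)
      show "finite S" by (auto simp: S_def intro: finite_PiE)
      show "J0 \<in> S" by (auto simp: S_def J0_def)
      show "h J \<ge> 0" for J by (auto simp: h_def g_def intro!: prod_nonneg)
      show "\<exists>B. \<forall>K. - B \<le> T J K" if "J \<in> S" for J
        unfolding T_def
      proof (rule exponential_sum_bounded_below)
        have "\<bar>c J $ i\<bar> \<le> real L" for i
          using that PiE_mem[of J UNIV "\<lambda>_. {..2*L}" i] by (auto simp: c_def S_def)
        moreover have "c J $ i \<in> \<int>" for i by (simp add: c_def)
        ultimately show "c J \<bullet> a \<in> \<int> \<longrightarrow> c J \<bullet> b \<in> \<int>" using rel by blast
      qed
    qed
    then obtain B where B: "\<And>K. h J0 * T J0 K - B \<le> (\<Sum>k<K. F (real k *\<^sub>R a - b))"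
      unfolding sum_F by blast
    have "c J0 = 0" by (simp add: c_def J0_def vec_eq_iff)
    hence T0: "T J0 K = real K" for K by (simp add: T_def)
    have h0: "h J0 = (real (2 * L choose L) / 4 ^ L) ^ m" by (simp add: h_def J0_def g_def m_def)
    \<comment> \<open>Otherwise the sum over \<open>k < K\<close> is at most
      \<open>K * q ^ L\<close>, while it is at least \<open>K * h J0 - B\<close> with
      \<open>h J0 > q ^ L\<close>; this fails for large \<open>K\<close>.\<close>
    have "\<exists>k. q ^ L < F (real k *\<^sub>R a - b)"
    proof (rule ccontr)
      assume "\<not> ?thesis"
      hence "(\<Sum>k<K. F (real k *\<^sub>R a - b)) \<le> real K * q ^ L" for K
        using sum_bounded_above[of "{..<K}" "\<lambda>k. F (real k *\<^sub>R a - b)" "q ^ L"]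
        by (simp add: not_less)
      hence "h J0 * real K - B \<le> real K * q ^ L" for K
        using B[of K] unfolding T0 by (rule order_trans[rotated])
      hence *: "real K * (h J0 - q ^ L) \<le> B" for K
        by (simp add: algebra_simps)
      have "0 < h J0 - q ^ L" using L h0 by simp
      then obtain K where "B < real K * (h J0 - q ^ L)" using reals_Archimedean3 by blast
      with * show False by (meson not_less)
    qed
    then obtain k where k: "q ^ L < F (real k *\<^sub>R a - b)" ..
    define z where "z = (\<chi> i. - real_of_int (round (real k * a $ i - b $ i)))"
    have "\<bar>real k * a $ i + z $ i - b $ i\<bar> < \<epsilon>" for i
    proof (rule ccontr)
      define t where "t = real k * a $ i - b $ i"
      assume "\<not> ?thesis"
      hence "\<bar>t - of_int (round t)\<bar> \<ge> e"
        using e by (simp add: z_def t_def algebra_simps)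
      hence t: "(1 + cos (2 * pi * t)) / 2 \<le> q"
        using cos_le_if_far_from_round[of e t] e by (simp add: q_def)
      define f where "f j = ((1 + cos (2 * pi * ((real k *\<^sub>R a - b) $ j))) / 2) ^ L" for j
      have f: "0 \<le> f j" "f j \<le> 1" for j
      proof -
        show "0 \<le> f j" "f j \<le> 1"
          using half_one_plus_cos[of "2 * pi * ((real k *\<^sub>R a - b) $ j)"] unfolding f_def
          by (auto intro: zero_le_power power_le_one)
      qed
      \<comment> \<open>One coordinate far from the integers suffices to make the product small,
        because all other factors lie in \<open>[0, 1]\<close>.\<close>
      have "F (real k *\<^sub>R a - b) = f i * (\<Prod>j\<in>UNIV-{i}. f j)"
        unfolding F_def f_def by (rule prod.remove) auto
      also have "\<dots> \<le> f i * 1"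
        using f by (intro mult_left_mono prod_le_1) auto
      also have "f i = ((1 + cos (2 * pi * t)) / 2) ^ L" by (simp add: f_def t_def)
      also have "\<dots> * 1 \<le> q ^ L"
        using power_mono[OF t half_one_plus_cos(1)] by simp
      finally show False using k by simp
    qed
    moreover have "\<forall>i. z $ i \<in> \<int>" by (simp add: z_def)
    ultimately show "\<exists>k::nat. \<exists>z. (\<forall>i. z $ i \<in> \<int>) \<and> (\<forall>i. \<bar>real k * a $ i + z $ i - b $ i\<bar> < \<epsilon>)"
      by (intro exI conjI allI) auto
  qed
qed

section \<open>Uniformly positive multiples in the simplex\<close>

lemma finite_bounded_int_vectors: "finite {d :: real^'m. \<forall>i. d $ i \<in> \<int> \<and> \<bar>d $ i\<bar> \<le> real M}"
proof (rule finite_subset)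
  let ?I = "real_of_int ` {- int M..int M}"
  show "{d :: real^'m. \<forall>i. d $ i \<in> \<int> \<and> \<bar>d $ i\<bar> \<le> real M}
      \<subseteq> (\<lambda>f. \<chi> i. f i) ` ((UNIV :: 'm set) \<rightarrow>\<^sub>E ?I)"
  proof
    fix d :: "real^'m"
    assume d: "d \<in> {d. \<forall>i. d $ i \<in> \<int> \<and> \<bar>d $ i\<bar> \<le> real M}"
    have "d $ i \<in> ?I" for i
    proof -
      obtain n where n: "d $ i = of_int n" using d by (auto elim: Ints_cases)
      moreover have "\<bar>d $ i\<bar> \<le> real M" using d by simp
      ultimately have "\<bar>n\<bar> \<le> int M" by linarith
      thus ?thesis using n by (intro image_eqI[of _ _ n]) auto
    qed
    hence "($) d \<in> UNIV \<rightarrow>\<^sub>E ?I" by auto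
    moreover have "d = (\<chi> i. d $ i)" by simp
    ultimately show "d \<in> (\<lambda>f. \<chi> i. f i) ` ((UNIV :: 'm set) \<rightarrow>\<^sub>E ?I)" by blast
  qed
  show "finite ((\<lambda>f. \<chi> i. f i) ` ((UNIV :: 'm set) \<rightarrow>\<^sub>E ?I))"
    by (intro finite_imageI finite_PiE) auto
qed

text \<open>On the hyperplane of coordinate sum 1, integer-valued relations can be replaced by
  homogeneous ones, at the cost of doubling the bound on the coefficients. Homogeneous relations
  define subspaces, which is what the later induction needs.\<close>

lemma kronecker_simplex:
  fixes a b :: "real^'m"
  assumes N: "\<forall>a b :: real^'m.
      (\<forall>c. (\<forall>i. c $ i \<in> \<int> \<and> \<bar>c $ i\<bar> \<le> real N) \<and> c \<bullet> a \<in> \<int> \<longrightarrow> c \<bullet> b \<in> \<int>) \<longrightarrow>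
      (\<exists>k::nat. \<exists>z. (\<forall>i. z $ i \<in> \<int>) \<and> (\<forall>i. \<bar>real k * a $ i + z $ i - b $ i\<bar> < \<epsilon>))"
    and e: "real CARD('m) * \<epsilon> \<le> 1"
    and a: "\<And>i. 0 < a $ i" "(\<Sum>i\<in>UNIV. a $ i) = 1"
    and b: "(\<Sum>i\<in>UNIV. b $ i) = 1"
    and rel: "\<And>d. (\<And>i. d $ i \<in> \<int> \<and> \<bar>d $ i\<bar> \<le> real (2 * N)) \<Longrightarrow> d \<bullet> a = 0 \<Longrightarrow> d \<bullet> b = 0"
  shows "\<exists>k::nat. \<exists>z. (\<forall>i. z $ i \<in> \<int>) \<and> (\<Sum>i\<in>UNIV. real k * a $ i + z $ i) = 1 \<and>
    (\<forall>i. b $ i - \<epsilon> < real k * a $ i + z $ i)"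
proof -
  have ints: "c \<bullet> b \<in> \<int>" if c: "\<forall>i. c $ i \<in> \<int> \<and> \<bar>c $ i\<bar> \<le> real N" and w: "c \<bullet> a \<in> \<int>" for c
  proof -
    \<comment> \<open>Subtracting the integer \<open>c \<bullet> a\<close> from every entry of
      \<open>c\<close> gives a vector orthogonal to \<open>a\<close>, as the entries of
      \<open>a\<close> sum to 1. Moreover \<open>\<bar>c \<bullet> a\<bar> \<le> N\<close>, whence
      the bound \<open>2 * N\<close>.\<close>
    define d where "d = c - (\<chi> i. c \<bullet> a)"
    have one: "(\<chi> i. c \<bullet> a) \<bullet> x = (c \<bullet> a) * (\<Sum>i\<in>UNIV. x $ i)" for x :: "real^'m"
      by (simp add: inner_vec_def sum_distrib_left)
    have "\<bar>c \<bullet> a\<bar> \<le> (\<Sum>i\<in>UNIV. \<bar>c $ i * a $ i\<bar>)"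
      unfolding inner_vec_def inner_real_def by (rule sum_abs)
    also have "\<dots> \<le> (\<Sum>i\<in>UNIV. real N * a $ i)"
      using c a by (intro sum_mono) (auto simp: abs_mult less_imp_le intro!: mult_mono)
    also have "\<dots> = real N" using a by (simp flip: sum_distrib_left)
    finally have ca: "\<bar>c \<bullet> a\<bar> \<le> real N" .
    have "d $ i \<in> \<int> \<and> \<bar>d $ i\<bar> \<le> real (2 * N)" for i
    proof -
      have "\<bar>c $ i\<bar> \<le> real N" using c by simp
      hence "\<bar>d $ i\<bar> \<le> real (2 * N)" using ca by (simp add: d_def)
      thus ?thesis using c w by (simp add: d_def)
    qed
    moreover have "d \<bullet> a = 0" using a by (simp add: d_def inner_diff_left one)
    ultimately have "d \<bullet> b = 0" using rel by blast
    hence "c \<bullet> b = c \<bullet> a" using b by (simp add: d_def inner_diff_left one)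
    thus ?thesis using w by simp
  qed
  then obtain k :: nat and z where z: "\<forall>i. z $ i \<in> \<int>"
    and kz: "\<forall>i. \<bar>real k * a $ i + z $ i - b $ i\<bar> < \<epsilon>"
    using N[THEN spec, THEN spec, THEN mp, of a b] by (auto intro: ints)
  \<comment> \<open>The approximation errors add up to less than 1, and \<open>?s\<close> is an
    integer, so it equals 1 exactly.\<close>
  let ?s = "\<Sum>i\<in>UNIV. real k * a $ i + z $ i"
  have "?s - 1 = (\<Sum>i\<in>UNIV. real k * a $ i + z $ i - b $ i)"
    using b by (simp add: sum_subtractf)
  hence "\<bar>?s - 1\<bar> \<le> (\<Sum>i\<in>UNIV. \<bar>real k * a $ i + z $ i - b $ i\<bar>)"
    by (simp only: sum_abs)
  also have "\<dots> < (\<Sum>i\<in>(UNIV::'m set). \<epsilon>)"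
    using kz by (intro sum_strict_mono) auto
  also have "\<dots> \<le> 1" using e by simp
  finally have "\<bar>?s - 1\<bar> < 1" .
  moreover have "?s = real k + (\<Sum>i\<in>UNIV. z $ i)"
    using a by (simp add: sum.distrib flip: sum_distrib_left)
  hence "?s - 1 \<in> \<int>" using z by (simp add: Ints_sum)
  ultimately have "?s - 1 = 0" using Ints_nonzero_abs_less1 by blast
  hence "?s = 1" by simp
  moreover have "b $ i - \<epsilon> < real k * a $ i + z $ i" for i
  proof -
    have "\<bar>real k * a $ i + z $ i - b $ i\<bar> < \<epsilon>" using kz by blast
    thus ?thesis by linarith
  qed
  ultimately show ?thesis using z by (intro exI conjI allI) auto
qed

text \<open>Induction on \<open>dim W\<close>. A positive \<open>b \<in> W\<close> serves as target
  for Kronecker approximation. It fails only for \<open>a\<close> orthogonal to one of finitely many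
  short \<open>d\<close> with \<open>d \<bullet> b \<noteq> 0\<close>; such \<open>a\<close> lie in
  a proper subspace of \<open>W\<close>, since \<open>b\<close> does not.\<close>

lemma uniformly_positive_multiple_subspace:
  fixes W :: "(real^'m) set"
  assumes "subspace W"
  shows "\<exists>\<delta>>0. \<forall>a\<in>W. (\<forall>i. 0 < a $ i) \<and> (\<Sum>i\<in>UNIV. a $ i) = 1 \<longrightarrow>
    (\<exists>k::nat. \<exists>z. (\<forall>i. z $ i \<in> \<int>) \<and> (\<Sum>i\<in>UNIV. real k * a $ i + z $ i) = 1 \<and>
      (\<forall>i. \<delta> \<le> real k * a $ i + z $ i))"
  using assms
proof (induction "dim W" arbitrary: W rule: less_induct)
  case less
  define Q :: "(real^'m) \<Rightarrow> real \<Rightarrow> bool" where "Q a \<delta> \<longleftrightarrow>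
     (\<exists>k::nat. \<exists>z. (\<forall>i. z $ i \<in> \<int>) \<and> (\<Sum>i\<in>UNIV. real k * a $ i + z $ i) = 1 \<and>
      (\<forall>i. \<delta> \<le> real k * a $ i + z $ i))" for a \<delta>
  have Q_mono: "Q a \<delta> \<Longrightarrow> \<delta>' \<le> \<delta> \<Longrightarrow> Q a \<delta>'" for a \<delta> \<delta>'
    unfolding Q_def by (meson order_trans)
  define pos :: "real^'m \<Rightarrow> bool" where "pos a \<longleftrightarrow> (\<forall>i. 0 < a $ i) \<and> (\<Sum>i\<in>UNIV. a $ i) = 1" for a
  have "\<exists>\<delta>>0. \<forall>a\<in>W. pos a \<longrightarrow> Q a \<delta>"
  proof (cases "\<exists>b\<in>W. pos b")
    case False
    thus ?thesis by (intro exI[of _ 1]) auto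
  next
    case True
    then obtain b where b: "b \<in> W" "pos b" ..
    \<comment> \<open>Half the least entry of \<open>b\<close>: an error below
      \<open>\<epsilon>\<close> leaves every entry at least \<open>\<epsilon>\<close>.\<close>
    define \<epsilon> where "\<epsilon> = Min (range (($) b)) / 2"
    have "\<epsilon> > 0" using b by (auto simp: \<epsilon>_def pos_def)
    have eb: "2 * \<epsilon> \<le> b $ i" for i by (simp add: \<epsilon>_def)
    have "real CARD('m) * (2 * \<epsilon>) \<le> (\<Sum>i\<in>UNIV. b $ i)"
      using sum_bounded_below[of UNIV "2 * \<epsilon>" "($) b"] eb by simp
    hence e: "real CARD('m) * \<epsilon> \<le> 1" using b \<open>\<epsilon> > 0\<close> mult_nonneg_nonneg[of "real CARD('m)" \<epsilon>]
      unfolding pos_def by auto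
    obtain N :: nat where N: "\<forall>a b :: real^'m.
      (\<forall>c. (\<forall>i. c $ i \<in> \<int> \<and> \<bar>c $ i\<bar> \<le> real N) \<and> c \<bullet> a \<in> \<int> \<longrightarrow> c \<bullet> b \<in> \<int>) \<longrightarrow>
      (\<exists>k::nat. \<exists>z. (\<forall>i. z $ i \<in> \<int>) \<and> (\<forall>i. \<bar>real k * a $ i + z $ i - b $ i\<bar> < \<epsilon>))"
      using kronecker_uniform[OF \<open>\<epsilon> > 0\<close>] by blast
    define D where "D = {d :: real^'m. \<forall>i. d $ i \<in> \<int> \<and> \<bar>d $ i\<bar> \<le> real (2 * N)}"
    have "\<exists>\<delta>>0. \<forall>a\<in>W \<inter> {x. d \<bullet> x = 0}. pos a \<longrightarrow> Q a \<delta>" if "d \<bullet> b \<noteq> 0" for d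
      unfolding Q_def pos_def
    proof (rule less.hyps)
      show sub: "subspace (W \<inter> {x. d \<bullet> x = 0})"
        by (intro subspace_inter less.prems subspace_hyperplane)
      have "W \<inter> {x. d \<bullet> x = 0} \<subset> W" using b that by auto
      thus "dim (W \<inter> {x. d \<bullet> x = 0}) < dim W"
        using sub less.prems by (intro dim_psubset) (simp add: span_eq_iff[THEN iffD2])
    qed
    hence "\<forall>d. \<exists>\<delta>. d \<bullet> b \<noteq> 0 \<longrightarrow> \<delta> > 0 \<and> (\<forall>a\<in>W \<inter> {x. d \<bullet> x = 0}. pos a \<longrightarrow> Q a \<delta>)"
      by blast
    then obtain f where "\<forall>d. d \<bullet> b \<noteq> 0 \<longrightarrow> f d > 0 \<and> (\<forall>a\<in>W \<inter> {x. d \<bullet> x = 0}. pos a \<longrightarrow> Q a (f d))"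
      by (rule choice[THEN exE])
    hence f: "\<And>d. d \<bullet> b \<noteq> 0 \<Longrightarrow> f d > 0"
      "\<And>d a. d \<bullet> b \<noteq> 0 \<Longrightarrow> a \<in> W \<Longrightarrow> d \<bullet> a = 0 \<Longrightarrow> pos a \<Longrightarrow> Q a (f d)"
      by auto
    \<comment> \<open>\<open>\<epsilon>\<close> is the constant of the generic case, the other
      elements those of the smaller subspaces; finiteness makes the minimum positive.\<close>
    define E where "E = insert \<epsilon> (f ` {d\<in>D. d \<bullet> b \<noteq> 0})"
    have "finite D" unfolding D_def by (rule finite_bounded_int_vectors)
    hence E: "finite E" "E \<noteq> {}" by (auto simp: E_def)
    have "Min E > 0" using E f \<open>\<epsilon> > 0\<close> by (auto simp: E_def)
    moreover have "Q a (Min E)" if a: "a \<in> W" "pos a" for a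
    proof (cases "\<exists>d\<in>D. d \<bullet> a = 0 \<and> d \<bullet> b \<noteq> 0")
      case True
      then obtain d where "d \<in> D" "d \<bullet> a = 0" "d \<bullet> b \<noteq> 0" by blast
      hence "Q a (f d)" "Min E \<le> f d" using f a E by (auto intro: Min_le simp: E_def)
      thus ?thesis by (rule Q_mono)
    next
      case False
      hence "\<exists>k::nat. \<exists>z. (\<forall>i. z $ i \<in> \<int>) \<and> (\<Sum>i\<in>UNIV. real k * a $ i + z $ i) = 1 \<and>
        (\<forall>i. b $ i - \<epsilon> < real k * a $ i + z $ i)"
        using a b by (intro kronecker_simplex[OF N e]) (auto simp: pos_def D_def)
      then obtain k :: nat and z where "\<forall>i. z $ i \<in> \<int>" "(\<Sum>i\<in>UNIV. real k * a $ i + z $ i) = 1"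
        and kz: "\<And>i. b $ i - \<epsilon> < real k * a $ i + z $ i" by blast
      moreover have "\<epsilon> \<le> real k * a $ i + z $ i" for i
        using kz[of i] eb[of i] by linarith
      ultimately have "Q a \<epsilon>" unfolding Q_def by blast
      moreover have "Min E \<le> \<epsilon>" using E by (auto intro: Min_le simp: E_def)
      ultimately show ?thesis by (rule Q_mono)
    qed
    ultimately show ?thesis by blast
  qed
  thus ?case unfolding Q_def pos_def .
qed

section \<open>Lattice-free cross polytopes\<close>

text \<open>The l1 ball in coefficient space. For \<open>r > 0\<close>, its image under a matrix
  \<open>A\<close> is the convex hull of the vectors \<open>\<plusminus> r\<close> times a column of
  \<open>A\<close>.\<close>

definition cross_polytope :: "real \<Rightarrow> (real^'n) set" where
  "cross_polytope r = {c. (\<Sum>i\<in>UNIV. \<bar>c $ i\<bar>) \<le> r}"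

lemma convex_cross_polytope: "convex (cross_polytope r)"
proof (rule convexI)
  fix x y :: "real^'n" and u v :: real
  assume *: "x \<in> cross_polytope r" "y \<in> cross_polytope r" "0 \<le> u" "0 \<le> v" "u + v = 1"
  have "(\<Sum>i\<in>UNIV. \<bar>(u *\<^sub>R x + v *\<^sub>R y) $ i\<bar>) \<le> (\<Sum>i\<in>UNIV. u * \<bar>x $ i\<bar> + v * \<bar>y $ i\<bar>)"
  proof (rule sum_mono)
    fix i
    have "\<bar>u * x $ i + v * y $ i\<bar> \<le> \<bar>u * x $ i\<bar> + \<bar>v * y $ i\<bar>" by (rule abs_triangle_ineq)
    thus "\<bar>(u *\<^sub>R x + v *\<^sub>R y) $ i\<bar> \<le> u * \<bar>x $ i\<bar> + v * \<bar>y $ i\<bar>"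
      using * by (simp add: abs_mult)
  qed
  also have "\<dots> = u * (\<Sum>i\<in>UNIV. \<bar>x $ i\<bar>) + v * (\<Sum>i\<in>UNIV. \<bar>y $ i\<bar>)"
    by (simp add: sum.distrib sum_distrib_left)
  also have "\<dots> \<le> r"
    using * by (intro convex_bound_le) (auto simp: cross_polytope_def)
  finally show "u *\<^sub>R x + v *\<^sub>R y \<in> cross_polytope r" by (simp add: cross_polytope_def)
qed

lemma closed_cross_polytope: "closed (cross_polytope r)"
  unfolding cross_polytope_def by (intro closed_Collect_le continuous_intros)

lemma bounded_cross_polytope: "bounded (cross_polytope r :: (real^'n) set)"
  unfolding bounded_iff cross_polytope_def using norm_le_l1_cart order_trans by blast

text \<open>With \<open>S\<close> the sum of the \<open>\<bar>d i\<bar>\<close>, if nonzero, the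
  vector is \<open>S\<close> times a convex combination of the points
  \<open>sgn (d i) *\<^sub>R p i\<close>, plus \<open>1 - S\<close> times the origin.\<close>

lemma convex_symmetric_sum_mem:
  assumes C: "convex C" "\<And>u. u \<in> C \<Longrightarrow> - u \<in> C" "0 \<in> C"
    and "finite I" and p: "\<And>i. i \<in> I \<Longrightarrow> p i \<in> C" and d: "(\<Sum>i\<in>I. \<bar>d i\<bar>) \<le> 1"
  shows "(\<Sum>i\<in>I. d i *\<^sub>R p i) \<in> C"
proof (cases "(\<Sum>i\<in>I. \<bar>d i\<bar>) = 0")
  case True
  hence "d i = 0" if "i \<in> I" for i using \<open>finite I\<close> that by (simp add: sum_nonneg_eq_0_iff)
  thus ?thesis using C by (simp add: sum.neutral)
next
  case False
  define S where "S = (\<Sum>i\<in>I. \<bar>d i\<bar>)"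
  have S: "0 < S" "S \<le> 1" using False d by (simp_all add: S_def less_le sum_nonneg)
  have "(\<Sum>i\<in>I. (\<bar>d i\<bar> / S) *\<^sub>R (sgn (d i) *\<^sub>R p i)) \<in> C"
  proof (rule convex_sum[OF \<open>finite I\<close> C(1)])
    show "(\<Sum>i\<in>I. \<bar>d i\<bar> / S) = 1" using S by (simp add: S_def flip: sum_divide_distrib)
    show "sgn (d i) *\<^sub>R p i \<in> C" if "i \<in> I" for i
      using C p[OF that] by (cases "d i" "0::real" rule: linorder_cases) auto
  qed (use S in auto)
  hence "S *\<^sub>R (\<Sum>i\<in>I. (\<bar>d i\<bar> / S) *\<^sub>R (sgn (d i) *\<^sub>R p i)) + (1 - S) *\<^sub>R 0 \<in> C"
    using S C by (intro convexD) auto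
  also have "S *\<^sub>R (\<Sum>i\<in>I. (\<bar>d i\<bar> / S) *\<^sub>R (sgn (d i) *\<^sub>R p i)) + (1 - S) *\<^sub>R 0
      = (\<Sum>i\<in>I. d i *\<^sub>R p i)"
    using S unfolding scaleR_sum_right
    by (simp add: abs_mult_sgn)
  finally show ?thesis .
qed

lemma cross_polytope_image_subset:
  fixes A :: "real^'n^'n"
  assumes C: "convex C" "\<And>u. u \<in> C \<Longrightarrow> - u \<in> C" "0 \<in> C"
    and "0 < r" and p: "\<And>j. r *\<^sub>R column j A \<in> C"
  shows "(*v) A ` cross_polytope r \<subseteq> C"
proof clarify
  fix c :: "real^'n"
  assume "c \<in> cross_polytope r"
  hence "(\<Sum>i\<in>UNIV. \<bar>c $ i / r\<bar>) \<le> 1"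
    using \<open>0 < r\<close> by (simp add: cross_polytope_def flip: sum_divide_distrib)
  hence "(\<Sum>i\<in>UNIV. (c $ i / r) *\<^sub>R (r *\<^sub>R column i A)) \<in> C"
    using C p by (intro convex_symmetric_sum_mem) auto
  thus "A *v c \<in> C"
    using \<open>0 < r\<close> by (simp add: matrix_mult_sum scalar_mult_eq_scaleR)
qed

section \<open>Determinant descent and volume bounds\<close>

lemma det_in_Ints:
  fixes A :: "real^'n^'n"
  assumes "\<And>i j. A $ i $ j \<in> \<int>"
  shows "det A \<in> \<int>"
  unfolding det_def by (intro Ints_sum Ints_mult Ints_prod) (auto simp: assms)

text \<open>Among the admissible integer matrices one takes a matrix of least \<open>\<bar>det\<bar>\<close>: a further
  lattice point of the cross polytope could replace a column and decrease the determinant.\<close>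

lemma ex_lattice_free_cross_polytope:
  fixes A0 :: "real^'n^'n"
  assumes C: "convex C" "\<And>u. u \<in> C \<Longrightarrow> - u \<in> C" "0 \<in> C"
    and r: "0 < r" "r < 1"
    and A0: "\<And>j. column j A0 \<in> int_points" "\<And>j. r *\<^sub>R column j A0 \<in> C" "det A0 \<noteq> 0"
  obtains A :: "real^'n^'n" where "\<And>j. column j A \<in> int_points" "\<And>j. r *\<^sub>R column j A \<in> C"
    "det A \<noteq> 0" "(*v) A ` cross_polytope r \<inter> int_points = {0}"
proof -
  define good :: "real^'n^'n \<Rightarrow> bool" where
    "good A \<longleftrightarrow> (\<forall>j. column j A \<in> int_points \<and> r *\<^sub>R column j A \<in> C) \<and> det A \<noteq> 0" for A
  have det_int: "det B \<in> \<int>" if "good B" for B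
    using that by (intro det_in_Ints) (auto simp: good_def int_points_def column_def)
  \<comment> \<open>Determinants of \<open>good\<close> matrices are integers, so the floor loses
    nothing and a minimum exists.\<close>
  define A where "A = (ARG_MIN (\<lambda>A. nat \<lfloor>\<bar>det A\<bar>\<rfloor>) A. good A)"
  have "good A0" using A0 by (auto simp: good_def)
  hence A: "good A" and least: "\<And>B. good B \<Longrightarrow> nat \<lfloor>\<bar>det A\<bar>\<rfloor> \<le> nat \<lfloor>\<bar>det B\<bar>\<rfloor>"
    unfolding A_def by (auto intro: arg_min_natI arg_min_nat_le)
  have minimal: "\<bar>det A\<bar> \<le> \<bar>det B\<bar>" if B: "good B" for B
  proof -
    obtain m n where mn: "det A = of_int m" "det B = of_int n"
      using det_int[OF A] det_int[OF B] unfolding Ints_def by blast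
    have "nat \<bar>m\<bar> \<le> nat \<bar>n\<bar>" using least[OF B] by (simp add: mn flip: of_int_abs)
    thus ?thesis by (simp add: mn)
  qed
  have "z = 0" if z: "z \<in> (*v) A ` cross_polytope r" "z \<in> int_points" for z
  proof (rule ccontr)
    assume "z \<noteq> 0"
    obtain c where c: "z = A *v c" "c \<in> cross_polytope r" using z by blast
    then obtain k where k: "c $ k \<noteq> 0" using \<open>z \<noteq> 0\<close> by (metis matrix_vector_mult_0_right vec_eq_iff zero_index)
    \<comment> \<open>Column \<open>k\<close> becomes \<open>z\<close>. By Cramer's rule the
      determinant is multiplied by \<open>c $ k\<close>, which is nonzero and of absolute value at
      most \<open>r < 1\<close>, contradicting minimality.\<close>
    define B :: "real^'n^'n" where "B = (\<chi> i j. if j = k then (A *v c) $ i else A $ i $ j)"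
    have col: "column j B = (if j = k then z else column j A)" for j
      by (simp add: column_def B_def c vec_eq_iff)
    have detB: "det B = c $ k * det A" unfolding B_def by (rule cramer_lemma)
    have "z \<in> C"
      using cross_polytope_image_subset[OF C \<open>0 < r\<close>] A z(1) by (auto simp: good_def)
    hence "r *\<^sub>R z + (1 - r) *\<^sub>R 0 \<in> C" using C r by (intro convexD) auto
    hence "good B" using A z k detB by (auto simp: good_def col)
    hence "\<bar>det A\<bar> \<le> \<bar>c $ k\<bar> * \<bar>det A\<bar>" using minimal detB by (metis abs_mult)
    moreover have "\<bar>c $ k\<bar> \<le> (\<Sum>i\<in>UNIV. \<bar>c $ i\<bar>)" by (rule member_le_sum) auto
    hence "\<bar>c $ k\<bar> < 1" using c r by (simp add: cross_polytope_def)
    ultimately show False using A by (simp add: good_def)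
  qed
  moreover have "0 \<in> (*v) A ` cross_polytope r"
    using r by (intro image_eqI[of _ _ 0]) (auto simp: cross_polytope_def)
  ultimately have "(*v) A ` cross_polytope r \<inter> int_points = {0}"
    by (auto simp: int_points_def)
  with A show ?thesis by (intro that) (auto simp: good_def)
qed

text \<open>Cut the unit cube into pieces that integer translations carry into \<open>S\<close>. The
  translated pieces are disjoint, because two points of the open cube cannot differ by a nonzero
  integer vector; so \<open>S\<close> has at least the volume of the cube.\<close>

lemma measure_ge_1_if_integer_translates_cover:
  fixes S :: "(real^'n) set"
  assumes "compact S" and cover: "\<And>x. \<exists>z\<in>int_points. x - z \<in> S"
  shows "1 \<le> measure lebesgue S"
proof -
  obtain M :: nat where M: "\<And>x. x \<in> S \<Longrightarrow> norm x \<le> real M"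
    by (meson assms(1) bounded_iff compact_imp_bounded order_trans real_nat_ceiling_ge)
  define Q :: "(real^'n) set" where "Q = box 0 1"
  \<comment> \<open>The only translations that matter: points of the cube have entries in
    \<open>(0, 1)\<close> and those of \<open>S\<close> have norm at most \<open>M\<close>.\<close>
  define Z :: "(real^'n) set" where "Z = {d. \<forall>i. d $ i \<in> \<int> \<and> \<bar>d $ i\<bar> \<le> real (M + 1)}"
  have "finite Z" unfolding Z_def by (rule finite_bounded_int_vectors)
  have Q: "x \<in> Q \<longleftrightarrow> (\<forall>i. 0 < x $ i \<and> x $ i < 1)" for x
    by (simp add: Q_def mem_box_cart)
  define T where "T z = (+) (- z) ` Q \<inter> S" for z
  have T_Q: "x + z \<in> Q" if "x \<in> T z" for x z
    using that by (auto simp: T_def)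
  have meas: "T z \<in> lmeasurable" "(+) z ` T z \<in> lmeasurable" for z
    unfolding T_def Q_def using \<open>compact S\<close>
    by (blast intro: fmeasurable.Int lmeasurable_compact measurable_translation lmeasurable_box)+
  have "1 \<bullet> b = 1" if "b \<in> Basis" for b :: "real^'n"
    using that by (auto simp: Basis_vec_def inner_axis)
  hence "1 = measure lebesgue Q"
    by (simp add: Q_def measure_lborel_box_eq)
  also have "\<dots> \<le> measure lebesgue (\<Union>z\<in>Z. (+) z ` T z)"
  proof (rule measure_mono_fmeasurable)
    show "Q \<subseteq> (\<Union>z\<in>Z. (+) z ` T z)"
    proof
      fix x assume x: "x \<in> Q"
      obtain z where z: "z \<in> int_points" "x - z \<in> S" using cover by blast
      have "\<bar>z $ i\<bar> \<le> real (M + 1)" for i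
      proof -
        have "\<bar>x $ i - z $ i\<bar> \<le> real M"
          using component_le_norm_cart[of "x - z" i] M[OF z(2)] by simp
        moreover have "0 < x $ i" "x $ i < 1" using x Q by auto
        ultimately show ?thesis by simp
      qed
      hence "z \<in> Z" using z by (auto simp: Z_def int_points_def)
      moreover have "x - z \<in> T z" using z x by (auto simp: T_def)
      hence "x \<in> (+) z ` T z" by (rule image_eqI[rotated]) simp
      ultimately show "x \<in> (\<Union>z\<in>Z. (+) z ` T z)" by blast
    qed
  qed (use \<open>finite Z\<close> in \<open>auto simp: Q_def intro!: fmeasurable.finite_UN meas\<close>)
  also have "\<dots> \<le> (\<Sum>z\<in>Z. measure lebesgue ((+) z ` T z))"
    by (rule measure_UNION_le[OF \<open>finite Z\<close> fmeasurableD[OF meas(2)]])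
  also have "\<dots> = (\<Sum>z\<in>Z. measure lebesgue (T z))"
    by (simp add: measure_translation)
  also have "\<dots> = measure lebesgue (\<Union>z\<in>Z. T z)"
  proof (rule measure_finite_Union[symmetric])
    show "disjoint_family_on T Z"
    proof (unfold disjoint_family_on_def, intro ballI impI equals0I)
      fix z w x
      assume zw: "z \<in> Z" "w \<in> Z" "z \<noteq> w" and x: "x \<in> T z \<inter> T w"
      have "z $ i = w $ i" for i
      proof -
        have "x + z \<in> Q" "x + w \<in> Q" using x T_Q by blast+
        hence "\<bar>z $ i - w $ i\<bar> < 1" unfolding Q by (simp add: abs_less_iff) (smt (verit))
        moreover have "z $ i - w $ i \<in> \<int>" using zw by (simp add: Z_def)
        ultimately have "z $ i - w $ i = 0" using Ints_nonzero_abs_less1 by blast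
        thus ?thesis by simp
      qed
      thus False using zw by (simp add: vec_eq_iff)
    qed
    show "T ` Z \<subseteq> sets lebesgue" using meas(1) by blast
    show "emeasure lebesgue (T z) \<noteq> \<infinity>" for z using fmeasurableD2[OF meas(1)] by simp
  qed fact
  also have "\<dots> \<le> measure lebesgue S"
  proof (rule measure_mono_fmeasurable)
    show "(\<Union>z\<in>Z. T z) \<in> sets lebesgue"
      by (rule sets.finite_UN[OF \<open>finite Z\<close> fmeasurableD[OF meas(1)]])
  qed (use lmeasurable_compact[OF \<open>compact S\<close>] in \<open>auto simp: T_def\<close>)
  finally show ?thesis .
qed

lemma compact_cross_polytope_image: "compact ((*v) A ` cross_polytope r :: (real^'n) set)"
  for A :: "real^'n^'n"
proof (rule compact_continuous_image)
  show "continuous_on (cross_polytope r) ((*v) A)"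
    by (intro linear_continuous_on) (simp add: matrix_vector_mul_bounded_linear)
  show "compact (cross_polytope r :: (real^'n) set)"
    by (simp add: bounded_cross_polytope closed_cross_polytope compact_eq_bounded_closed)
qed

text \<open>The translates of the parallelepiped spanned by the columns of \<open>A\<close> cover the space.\<close>

lemma measure_cross_polytope_image_ge:
  fixes A :: "real^'n^'n"
  assumes "0 < r" and A: "\<And>j. column j A \<in> int_points" "det A \<noteq> 0"
  shows "(r / real CARD('n)) ^ CARD('n) \<le> measure lebesgue ((*v) A ` cross_polytope r)"
proof -
  define X where "X = (*v) A ` cross_polytope r"
  \<comment> \<open>Dilating by \<open>t\<close> turns the radius \<open>r\<close> into
    \<open>CARD('n)\<close>, so that the coefficient ball contains the unit cube.\<close>
  define t where "t = real CARD('n) / r"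
  have t: "0 < t" using \<open>0 < r\<close> by (simp add: t_def)
  have "compact X" unfolding X_def by (rule compact_cross_polytope_image)
  have "1 \<le> measure lebesgue ((*\<^sub>R) t ` X)"
  proof (rule measure_ge_1_if_integer_translates_cover)
    show "compact ((*\<^sub>R) t ` X)" using \<open>compact X\<close> by (rule compact_scaling)
    fix x :: "real^'n"
    obtain B where "A ** B = mat 1" using A(2) by (auto simp: invertible_def simp flip: invertible_det_nz)
    define c where "c = B *v x"
    have "A *v c = x" by (simp add: c_def matrix_vector_mul_assoc \<open>A ** B = mat 1\<close>)
    \<comment> \<open>Rounding the coefficients down gives an integer point \<open>A *v f\<close>,
      and the fractional parts have l1 norm at most \<open>CARD('n)\<close>.\<close>
    define f :: "real^'n" where "f = (\<chi> i. of_int \<lfloor>c $ i\<rfloor>)"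
    have "(A *v f) $ i \<in> \<int>" for i
      using A(1) by (auto simp: matrix_vector_mult_def f_def int_points_def column_def intro!: Ints_sum Ints_mult)
    hence "A *v f \<in> int_points" by (simp add: int_points_def)
    moreover have "x - A *v f \<in> (*\<^sub>R) t ` X"
    proof -
      have "(\<Sum>i\<in>UNIV. \<bar>c $ i - f $ i\<bar>) \<le> (\<Sum>i\<in>(UNIV::'n set). 1)"
        by (intro sum_mono) (simp add: f_def abs_if, linarith)
      hence "(\<Sum>i\<in>UNIV. \<bar>c $ i - f $ i\<bar>) / t \<le> real CARD('n) / t"
        using t by (intro divide_right_mono) auto
      also have "\<dots> = r" using \<open>0 < r\<close> by (simp add: t_def)
      finally have "(1 / t) *\<^sub>R (c - f) \<in> cross_polytope r"
        using t by (simp add: cross_polytope_def abs_mult sum_divide_distrib)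
      hence "A *v ((1 / t) *\<^sub>R (c - f)) \<in> X" unfolding X_def by blast
      moreover have "x - A *v f = t *\<^sub>R (A *v ((1 / t) *\<^sub>R (c - f)))"
        using t \<open>A *v c = x\<close> by (simp add: matrix_vector_mult_scaleR matrix_vector_mult_diff_distrib)
      ultimately show ?thesis by blast
    qed
    ultimately show "\<exists>z\<in>int_points. x - z \<in> (*\<^sub>R) t ` X" by blast
  qed
  also have "\<dots> = t ^ CARD('n) * measure lebesgue X"
    using measure_lebesgue_affine[of t 0 X] t by simp
  finally show ?thesis using \<open>0 < r\<close> unfolding X_def[symmetric]
    by (simp add: t_def power_divide field_simps)
qed

lemma ex_body_of_fixed_volume:
  fixes A0 :: "real^'n^'n" and P :: "(real^'n) set"
  assumes "convex P" and x: "x \<in> P" "x \<in> int_points"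
    and r: "0 < r" "r < 1"
    and A0: "\<And>j. column j A0 \<in> int_points" "det A0 \<noteq> 0"
    and P: "\<And>j. x + r *\<^sub>R column j A0 \<in> P" "\<And>j. x - r *\<^sub>R column j A0 \<in> P"
  shows "\<exists>C. C \<subseteq> P \<and> convex_body C \<and> centrally_symmetric_wrt C x \<and>
     measure lebesgue C = (r / real CARD('n)) ^ CARD('n) \<and> C \<inter> int_points = {x}"
proof -
  \<comment> \<open>The part of \<open>P\<close> symmetric about \<open>x\<close>, translated to the
    origin.\<close>
  define D where "D = {u. x + u \<in> P \<and> x - u \<in> P}"
  have "convex D"
  proof (rule convexI)
    fix a b :: "real^'n" and u v :: real
    assume *: "a \<in> D" "b \<in> D" "0 \<le> u" "0 \<le> v" "u + v = 1"
    have "u *\<^sub>R (x + a) + v *\<^sub>R (x + b) \<in> P" "u *\<^sub>R (x - a) + v *\<^sub>R (x - b) \<in> P"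
      using * \<open>convex P\<close> by (auto simp: D_def intro: convexD)
    moreover have "u *\<^sub>R x + v *\<^sub>R x = x" using * by (metis scaleR_add_left scaleR_one)
    hence "u *\<^sub>R (x + a) + v *\<^sub>R (x + b) = x + (u *\<^sub>R a + v *\<^sub>R b)"
      "u *\<^sub>R (x - a) + v *\<^sub>R (x - b) = x - (u *\<^sub>R a + v *\<^sub>R b)"
      by (simp_all add: algebra_simps)
    ultimately show "u *\<^sub>R a + v *\<^sub>R b \<in> D" by (simp add: D_def)
  qed
  moreover have "\<And>u. u \<in> D \<Longrightarrow> - u \<in> D" "0 \<in> D" using x by (auto simp: D_def)
  ultimately have D: "convex D" "\<And>u. u \<in> D \<Longrightarrow> - u \<in> D" "0 \<in> D" by blast+
  obtain A :: "real^'n^'n" where A: "\<And>j. column j A \<in> int_points" "\<And>j. r *\<^sub>R column j A \<in> D"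
    "det A \<noteq> 0" "(*v) A ` cross_polytope r \<inter> int_points = {0}"
    using ex_lattice_free_cross_polytope[OF D r A0(1) _ A0(2)] P unfolding D_def by blast
  define X0 where "X0 = (*v) A ` cross_polytope r"
  define \<nu> where "\<nu> = (r / real CARD('n)) ^ CARD('n)"
  have "0 < \<nu>" using r by (simp add: \<nu>_def)
  moreover have "\<nu> \<le> measure lebesgue X0"
    unfolding \<nu>_def X0_def using r A by (intro measure_cross_polytope_image_ge) auto
  ultimately have V: "0 < measure lebesgue X0" "\<nu> \<le> measure lebesgue X0" "0 < \<nu>" by auto
  \<comment> \<open>Scaling by \<open>s\<close> brings the volume to exactly \<open>\<nu>\<close>.
    As \<open>s \<le> 1\<close>, the scaled body stays inside \<open>X0\<close> and acquires no
    further integer points.\<close>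
  define s where "s = root CARD('n) (\<nu> / measure lebesgue X0)"
  have s: "0 < s" "s \<le> 1" "s ^ CARD('n) = \<nu> / measure lebesgue X0" using V by (auto simp: s_def)
  have "compact X0" unfolding X0_def by (rule compact_cross_polytope_image)
  have "convex X0" unfolding X0_def by (intro convex_linear_image convex_cross_polytope) auto
  have "0 \<in> X0" using r unfolding X0_def by (intro image_eqI[of _ _ 0]) (auto simp: cross_polytope_def)
  have sym: "- u \<in> X0" if u: "u \<in> X0" for u
  proof -
    obtain c where "u = A *v c" "c \<in> cross_polytope r" using u by (auto simp: X0_def)
    hence "- u = A *v (- c)" "- c \<in> cross_polytope r"
      by (auto simp: cross_polytope_def linear_neg)
    thus ?thesis unfolding X0_def by blast
  qed
  define X where "X = (*\<^sub>R) s ` X0"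
  have X_sub: "X \<subseteq> X0"
  proof
    fix u assume "u \<in> X"
    then obtain v where v: "v \<in> X0" "u = s *\<^sub>R v" by (auto simp: X_def)
    have "s *\<^sub>R v + (1 - s) *\<^sub>R 0 \<in> X0"
      using s v \<open>convex X0\<close> \<open>0 \<in> X0\<close> by (intro convexD) auto
    thus "u \<in> X0" using v by simp
  qed
  have XD: "X \<subseteq> D" using X_sub cross_polytope_image_subset[OF D r(1) A(2)] by (auto simp: X0_def)
  have "0 \<in> X" using \<open>0 \<in> X0\<close> unfolding X_def by (intro image_eqI[of _ _ 0]) auto
  have symX: "- u \<in> X" if u: "u \<in> X" for u
    using u sym unfolding X_def by (metis (no_types, lifting) image_iff scaleR_minus_right)
  define C where "C = (+) x ` X"
  have "compact C" unfolding C_def X_def using \<open>compact X0\<close> by (intro compact_translation compact_scaling)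
  have "convex C" unfolding C_def X_def using \<open>convex X0\<close> by (intro convex_translation convex_scaling)
  have "measure lebesgue C = measure lebesgue X" unfolding C_def by (rule measure_translation)
  also have "\<dots> = s ^ CARD('n) * measure lebesgue X0"
    using measure_lebesgue_affine[of s 0 X0] s by (simp add: X_def)
  also have "\<dots> = \<nu>" using s V by simp
  finally have meas: "measure lebesgue C = \<nu>" .
  have "interior C \<noteq> {}"
  proof
    assume "interior C = {}"
    hence "negligible C" using \<open>convex C\<close> by (simp add: negligible_convex_interior)
    thus False using meas V negligible_imp_measure0 by force
  qed
  hence "convex_body C"
    using \<open>compact C\<close> \<open>convex C\<close> by (simp add: convex_body_def compact_imp_bounded compact_imp_closed)
  moreover have "centrally_symmetric_wrt C x"
  proof -
    have mem: "x + y \<in> C \<longleftrightarrow> y \<in> X" for y by (auto simp: C_def)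
    have "x \<in> C" using mem[of 0] \<open>0 \<in> X\<close> by simp
    moreover have "x + y \<in> C \<longleftrightarrow> x - y \<in> C" for y
      using mem[of y] mem[of "- y"] symX[of y] symX[of "- y"] by auto
    ultimately show ?thesis by (simp add: centrally_symmetric_wrt_def)
  qed
  moreover have "C \<subseteq> P" using XD by (auto simp: C_def D_def)
  moreover have "C \<inter> int_points = {x}"
  proof (intro equalityI subsetI)
    fix y assume y: "y \<in> C \<inter> int_points"
    hence "y - x \<in> X" "y - x \<in> int_points" using x by (auto simp: C_def int_points_def)
    hence "y - x = 0" using X_sub A(4) unfolding X0_def by blast
    thus "y \<in> {x}" by simp
  next
    fix y assume "y \<in> {x}"
    thus "y \<in> C \<inter> int_points" using x \<open>0 \<in> X\<close> by (auto simp: C_def)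
  qed
  ultimately show ?thesis using meas unfolding \<nu>_def by blast
qed

section \<open>Integral polyhedra\<close>

text \<open>Caratheodory's theorem with an index type of fixed size and strictly positive weights:
  points of weight 0 are dropped, the remaining ones are repeated to fill \<open>'n option\<close>,
  and each weight is split equally among the copies.\<close>

lemma convex_hull_positive_combination:
  fixes S :: "(real^'n) set"
  assumes "y \<in> convex hull S"
  shows "\<exists>(w :: 'n option \<Rightarrow> real^'n) u. (\<forall>i. w i \<in> S) \<and> (\<forall>i. 0 < u i) \<and>
    (\<Sum>i\<in>UNIV. u i) = 1 \<and> (\<Sum>i\<in>UNIV. u i *\<^sub>R w i) = y"
proof -
  obtain T v where T: "finite T" "T \<subseteq> S" "card T \<le> CARD('n) + 1" and v: "\<forall>x\<in>T. 0 \<le> v x" "sum v T = 1"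
    "(\<Sum>x\<in>T. v x *\<^sub>R x) = y"
    using assms unfolding convex_hull_caratheodory by auto
  define T' where "T' = {x\<in>T. v x \<noteq> 0}"
  have T': "finite T'" "T' \<subseteq> S" "card T' \<le> CARD('n option)"
    using T card_mono[of T T'] by (auto simp: T'_def)
  have v': "\<And>x. x \<in> T' \<Longrightarrow> 0 < v x" using v by (auto simp: T'_def less_le)
  have "sum v T' = sum v T"
    by (rule sum.mono_neutral_left[OF T(1)]) (auto simp: T'_def)
  hence sum1: "sum v T' = 1" using v by simp
  have "(\<Sum>x\<in>T'. v x *\<^sub>R x) = (\<Sum>x\<in>T. v x *\<^sub>R x)"
    by (rule sum.mono_neutral_left[OF T(1)]) (auto simp: T'_def)
  hence sumy: "(\<Sum>x\<in>T'. v x *\<^sub>R x) = y" using v by simp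
  have "T' \<noteq> {}" using sum1 by auto
  then obtain t0 where t0: "t0 \<in> T'" by blast
  obtain f :: "real^'n \<Rightarrow> 'n option" where f: "inj_on f T'"
    using card_le_inj[of T' "UNIV :: 'n option set"] T' by auto
  define w where "w i = (if i \<in> f ` T' then inv_into T' f i else t0)" for i
  have w: "w i \<in> T'" for i using t0 by (auto simp: w_def inv_into_into)
  have wf: "w (f x) = x" if "x \<in> T'" for x using f that by (simp add: w_def)
  define fib where "fib x = {i. w i = x}" for x
  have fib: "card (fib x) > 0" if "x \<in> T'" for x
    using wf[OF that] by (auto simp: card_gt_0_iff fib_def)
  define u where "u i = v (w i) / real (card (fib (w i)))" for i
  \<comment> \<open>Stated for general \<open>h\<close> to give both the total weight
    (\<open>h\<close> constantly 1) and the combination itself (\<open>h\<close> the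
    identity).\<close>
  have sum_u: "(\<Sum>i\<in>UNIV. u i *\<^sub>R h (w i)) = (\<Sum>x\<in>T'. v x *\<^sub>R h x)"
    for h :: "real^'n \<Rightarrow> 'b::real_vector"
  proof -
    have "(\<Sum>i\<in>UNIV. u i *\<^sub>R h (w i)) = (\<Sum>x\<in>T'. \<Sum>i\<in>{i\<in>UNIV. w i = x}. u i *\<^sub>R h (w i))"
      by (rule sum.group[symmetric]) (use T' w in auto)
    also have "\<dots> = (\<Sum>x\<in>T'. v x *\<^sub>R h x)"
    proof (rule sum.cong[OF refl])
      fix x assume x: "x \<in> T'"
      have "(\<Sum>i\<in>{i\<in>UNIV. w i = x}. u i *\<^sub>R h (w i)) = (\<Sum>i\<in>fib x. (v x / real (card (fib x))) *\<^sub>R h x)"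
      proof (rule sum.cong)
        show "{i \<in> UNIV. w i = x} = fib x" by (simp add: fib_def)
        show "u i *\<^sub>R h (w i) = (v x / real (card (fib x))) *\<^sub>R h x" if "i \<in> fib x" for i
        proof -
          have "w i = x" using that by (simp add: fib_def)
          thus ?thesis by (simp add: u_def)
        qed
      qed
      also have "\<dots> = v x *\<^sub>R h x" using fib[OF x] by (simp add: sum_constant_scaleR card_gt_0_iff)
      finally show "(\<Sum>i\<in>{i\<in>UNIV. w i = x}. u i *\<^sub>R h (w i)) = v x *\<^sub>R h x" .
    qed
    finally show ?thesis .
  qed
  show ?thesis
  proof (intro exI conjI allI)
    show "w i \<in> S" for i using w T' by blast
    show "0 < u i" for i using w[of i] fib v' by (simp add: u_def)
    show "(\<Sum>i\<in>UNIV. u i) = 1" using sum_u[of "\<lambda>_. 1::real"] sum1 by simp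
    show "(\<Sum>i\<in>UNIV. u i *\<^sub>R w i) = y" using sum_u[of "\<lambda>x. x"] sumy by simp
  qed
qed

lemma ex_indexed_basis_subset:
  fixes V :: "(real^'n) set"
  assumes "span V = UNIV"
  obtains h :: "'n \<Rightarrow> real^'n" where "\<And>i. h i \<in> V" "span (range h) = UNIV"
proof -
  obtain B where B: "B \<subseteq> V" "independent B" "V \<subseteq> span B"
    by (rule maximal_independent_subset)
  have "span B = UNIV" using B assms by (metis span_minimal subspace_span top.extremum_uniqueI)
  hence "card B = CARD('n)" using B(2) dim_eq_card[of B UNIV] by simp
  moreover have "finite B" using B(2) independent_bound by blast
  ultimately obtain h where "bij_betw h (UNIV :: 'n set) B"
    using finite_same_card_bij[of "UNIV :: 'n set" B] by auto
  hence "range h = B" by (simp add: bij_betw_def)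
  thus ?thesis using that[of h] B \<open>span B = UNIV\<close> by blast
qed

text \<open>A crude form of Steinitz's theorem: only the number of points matters.\<close>

lemma interior_point_positive_combination:
  fixes L :: "(real^'n) set"
  assumes x: "x \<in> interior (convex hull L)" "x \<in> L"
  obtains v :: "'n + 'n option \<Rightarrow> real^'n" and a :: "real^('n + 'n option)"
  where "\<And>i. v i \<in> L" "\<And>i. 0 < a $ i" "(\<Sum>i\<in>UNIV. a $ i) = 1"
    "(\<Sum>i\<in>UNIV. a $ i *\<^sub>R v i) = x" "span (range (\<lambda>i. v i - x)) = UNIV"
proof -
  have "affine hull (convex hull L) = UNIV"
    using x(1) by (intro affine_hull_nonempty_interior) auto
  hence "affine hull L = UNIV" by (simp add: affine_hull_convex_hull)
  hence *: "(\<lambda>y. x + y) ` span ((\<lambda>y. - x + y) ` (L - {x})) = UNIV"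
    using affine_hull_span2[OF x(2)] by simp
  have "y \<in> span ((\<lambda>y. y - x) ` L)" for y
  proof -
    have "x + y \<in> (\<lambda>y. x + y) ` span ((\<lambda>y. - x + y) ` (L - {x}))" unfolding * by simp
    hence "y \<in> span ((\<lambda>y. - x + y) ` (L - {x}))" by auto
    moreover have "(\<lambda>y. - x + y) ` (L - {x}) \<subseteq> (\<lambda>y. y - x) ` L" by auto
    ultimately show ?thesis using span_mono by blast
  qed
  hence "span ((\<lambda>y. y - x) ` L) = UNIV" by blast
  then obtain h :: "'n \<Rightarrow> real^'n" where h: "\<And>i. h i \<in> (\<lambda>y. y - x) ` L" "span (range h) = UNIV"
    using ex_indexed_basis_subset by blast
  define s where "s = (\<Sum>i\<in>UNIV. h i)"
  obtain e where e: "0 < e" "ball x e \<subseteq> convex hull L"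
    using x(1) by (auto simp: mem_interior)
  have n1: "0 < norm s + 1" by (rule add_nonneg_pos) auto
  \<comment> \<open>Small enough for \<open>x - t *\<^sub>R s\<close> to stay in the ball. Writing
    this point as a positive combination and adding \<open>t\<close> times each
    \<open>x + h i\<close> cancels \<open>s\<close>.\<close>
  define t where "t = e / (norm s + 1)"
  have t: "0 < t" using e by (simp add: t_def add_nonneg_pos)
  have "norm (t *\<^sub>R s) = e * (norm s / (norm s + 1))" using e by (simp add: t_def)
  also have "\<dots> < e * 1" using e n1 by (intro mult_strict_left_mono) auto
  finally have "x - t *\<^sub>R s \<in> ball x e" by (simp add: dist_norm)
  hence "x - t *\<^sub>R s \<in> convex hull L" using e by blast
  then obtain w :: "'n option \<Rightarrow> real^'n" and u where w: "\<And>i. w i \<in> L" and u: "\<And>i. 0 < u i" "(\<Sum>i\<in>UNIV. u i) = 1"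
    and uw: "(\<Sum>i\<in>UNIV. u i *\<^sub>R w i) = x - t *\<^sub>R s"
    using convex_hull_positive_combination[of "x - t *\<^sub>R s" L] by blast
  define n where "n = real CARD('n)"
  \<comment> \<open>The total weight before normalization: 1 from the \<open>u j\<close>, and
    \<open>t\<close> for each of the \<open>CARD('n)\<close> spanning points.\<close>
  define q where "q = 1 + n * t"
  have q: "0 < q" using t by (simp add: q_def n_def add_pos_nonneg)
  define v where "v = case_sum (\<lambda>i. x + h i) w"
  define a :: "real^('n + 'n option)" where "a = (\<chi> i. case_sum (\<lambda>_. t / q) (\<lambda>j. u j / q) i)"
  have sum_split: "(\<Sum>i\<in>UNIV. f i) = (\<Sum>i\<in>UNIV. f (Inl i)) + (\<Sum>j\<in>UNIV. f (Inr j))"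
    for f :: "'n + 'n option \<Rightarrow> 'b::comm_monoid_add"
    unfolding UNIV_Plus_UNIV[symmetric] by (subst sum.Plus) auto
  show thesis
  proof (rule that)
    have "x + h i \<in> L" for i using h(1)[of i] by auto
    thus "v i \<in> L" for i using w by (cases i) (simp_all add: v_def)
    show "0 < a $ i" for i using t q u by (cases i) (auto simp: a_def)
    show "(\<Sum>i\<in>UNIV. a $ i) = 1"
    proof -
      have "(\<Sum>i\<in>UNIV. a $ i) = n * (t / q) + (\<Sum>j\<in>UNIV. u j) / q"
        by (simp add: sum_split a_def n_def sum_divide_distrib)
      also have "\<dots> = (n * t + 1) / q" unfolding u(2) by (simp add: add_divide_distrib)
      finally show ?thesis using q by (simp add: q_def add.commute)
    qed
    have "(\<Sum>i\<in>UNIV. a $ i *\<^sub>R v i) =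
        (\<Sum>i\<in>UNIV. (t / q) *\<^sub>R (x + h i)) + (\<Sum>j\<in>UNIV. (u j / q) *\<^sub>R w j)"
      by (simp add: sum_split a_def v_def)
    also have "(\<Sum>i\<in>UNIV. (t / q) *\<^sub>R (x + h i)) = (1 / q) *\<^sub>R ((n * t) *\<^sub>R x + t *\<^sub>R s)"
      unfolding scaleR_right_distrib sum.distrib sum_constant_scaleR s_def n_def scaleR_sum_right
      by (simp add: mult.commute)
    also have "(\<Sum>j\<in>UNIV. (u j / q) *\<^sub>R w j) = (1 / q) *\<^sub>R (x - t *\<^sub>R s)"
      by (simp add: scaleR_sum_right flip: uw)
    also have "(1 / q) *\<^sub>R ((n * t) *\<^sub>R x + t *\<^sub>R s) + (1 / q) *\<^sub>R (x - t *\<^sub>R s) = (1 / q) *\<^sub>R (q *\<^sub>R x)"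
      by (simp add: q_def algebra_simps)
    also have "\<dots> = x" using q by simp
    finally show "(\<Sum>i\<in>UNIV. a $ i *\<^sub>R v i) = x" .
    have "range h \<subseteq> range (\<lambda>i. v i - x)"
    proof
      fix y assume "y \<in> range h"
      then obtain i where "y = h i" by blast
      hence "y = v (Inl i) - x" by (simp add: v_def)
      thus "y \<in> range (\<lambda>i. v i - x)" by blast
    qed
    thus "span (range (\<lambda>i. v i - x)) = UNIV" using h(2) span_mono by blast
  qed
qed

text \<open>The reflected point has coefficients \<open>(1 + \<delta>) * c j\<close>, reduced by
  \<open>\<delta>\<close> at \<open>j = i\<close>. They sum to 1 and are nonnegative because
  \<open>c i \<ge> \<delta>\<close>.\<close>

lemma reflected_point_mem:
  fixes v :: "'m::finite \<Rightarrow> 'b::real_vector"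
  assumes "convex P" and v: "\<And>i. v i \<in> P" and c: "\<And>i. \<delta> \<le> c i" "(\<Sum>i\<in>UNIV. c i) = 1"
    and "0 \<le> \<delta>" "x = (\<Sum>i\<in>UNIV. c i *\<^sub>R v i)"
  shows "x - \<delta> *\<^sub>R (v i - x) \<in> P"
proof -
  define d where "d j = (1 + \<delta>) * c j - (if j = i then \<delta> else 0)" for j
  have "x - \<delta> *\<^sub>R (v i - x) = (1 + \<delta>) *\<^sub>R x - \<delta> *\<^sub>R v i" by (simp add: algebra_simps)
  also have "\<dots> = (\<Sum>j\<in>UNIV. ((1 + \<delta>) * c j) *\<^sub>R v j) - (\<Sum>j\<in>UNIV. (if j = i then \<delta> else 0) *\<^sub>R v j)"
    by (simp add: assms(6) scaleR_sum_right if_distrib[of "\<lambda>r. r *\<^sub>R _"] cong: if_cong)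
  also have "\<dots> = (\<Sum>j\<in>UNIV. d j *\<^sub>R v j)"
    by (simp add: d_def scaleR_diff_left sum_subtractf)
  also have "\<dots> \<in> P"
  proof (rule convex_sum[OF _ \<open>convex P\<close>])
    have "(\<Sum>j\<in>UNIV. d j) = (1 + \<delta>) * (\<Sum>j\<in>UNIV. c j) - \<delta>"
      by (simp add: d_def sum_subtractf sum_distrib_left)
    thus "(\<Sum>j\<in>UNIV. d j) = 1" using c by simp
    show "0 \<le> d j" for j
    proof -
      have "0 \<le> c j" using c(1)[of j] \<open>0 \<le> \<delta>\<close> by linarith
      hence "0 \<le> \<delta> * c j" using \<open>0 \<le> \<delta>\<close> by simp
      hence "\<delta> \<le> (1 + \<delta>) * c j" "0 \<le> (1 + \<delta>) * c j"
        using c(1)[of j] \<open>0 \<le> \<delta>\<close> by (simp_all add: distrib_right add_increasing2)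
      thus ?thesis by (cases "j = i") (simp_all add: d_def)
    qed
  qed (use v in auto)
  finally show ?thesis .
qed

text \<open>The vector \<open>x - y\<close> is the combination of the \<open>v i - y\<close> with
  coefficients \<open>a i\<close>, so the new differences generate the old ones. This lets the
  centre move from the given interior point to the chosen one.\<close>

lemma span_differences_shift:
  fixes v :: "'m::finite \<Rightarrow> 'b::real_vector"
  assumes a: "(\<Sum>i\<in>UNIV. a i) = 1" "(\<Sum>i\<in>UNIV. a i *\<^sub>R v i) = x"
    and span: "span (range (\<lambda>i. v i - x)) = UNIV"
  shows "span (range (\<lambda>i. v i - y)) = UNIV"
proof -
  let ?V = "range (\<lambda>i. v i - y)"
  have "x - y = (\<Sum>i\<in>UNIV. a i *\<^sub>R (v i - y))"
    using a by (simp add: scaleR_diff_right sum_subtractf flip: scaleR_sum_left)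
  also have "\<dots> \<in> span ?V" by (intro span_sum span_scale span_base) auto
  finally have "x - y \<in> span ?V" .
  hence "(v i - y) - (x - y) \<in> span ?V" for i by (rule span_diff[rotated]) (auto intro: span_base)
  hence "range (\<lambda>i. v i - x) \<subseteq> span ?V" by auto
  hence "span (range (\<lambda>i. v i - x)) \<subseteq> span ?V" by (intro span_minimal) auto
  thus ?thesis using span by auto
qed

section \<open>Construction of the body in an integral polyhedron\<close>

lemma int_points_sum:
  "(\<And>i. i \<in> I \<Longrightarrow> z i \<in> \<int> \<and> v i \<in> int_points) \<Longrightarrow> (\<Sum>i\<in>I. z i *\<^sub>R v i) \<in> int_points"
  by (auto simp: int_points_def intro!: Ints_sum Ints_mult)

lemma ex_body_in_integral_polyhedron:
  fixes P :: "(real^'n) set"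
  assumes P: "integral_polyhedron P" "interior P \<inter> int_points \<noteq> {}"
    and \<delta>: "0 < \<delta>" "\<delta> < 1" "\<And>a :: real^('n + 'n option). (\<forall>i. 0 < a $ i) \<Longrightarrow> (\<Sum>i\<in>UNIV. a $ i) = 1 \<Longrightarrow>
      (\<exists>k::nat. \<exists>z. (\<forall>i. z $ i \<in> \<int>) \<and> (\<Sum>i\<in>UNIV. real k * a $ i + z $ i) = 1 \<and>
        (\<forall>i. \<delta> \<le> real k * a $ i + z $ i))"
  shows "\<exists>C x. C \<subseteq> P \<and> convex_body C \<and> centrally_symmetric_wrt C x \<and>
     measure lebesgue C = (\<delta> / real CARD('n)) ^ CARD('n) \<and> C \<inter> int_points = {x}"
proof -
  define L where "L = P \<inter> int_points"
  have PL: "P = convex hull L" using P(1) by (simp add: integral_polyhedron_def L_def)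
  hence "convex P" by simp
  obtain x0 where x0: "x0 \<in> interior P" "x0 \<in> int_points" using P(2) by blast
  hence "x0 \<in> L" using interior_subset by (auto simp: L_def)
  obtain v :: "'n + 'n option \<Rightarrow> real^'n" and a :: "real^('n + 'n option)"
    where v: "\<And>i. v i \<in> L" and a: "\<And>i. 0 < a $ i" "(\<Sum>i\<in>UNIV. a $ i) = 1"
    "(\<Sum>i\<in>UNIV. a $ i *\<^sub>R v i) = x0" and span0: "span (range (\<lambda>i. v i - x0)) = UNIV"
    using interior_point_positive_combination[of x0 L] x0(1) \<open>x0 \<in> L\<close> unfolding PL[symmetric] by blast
  obtain k :: nat and z where z: "\<forall>i. z $ i \<in> \<int>" and kz: "(\<Sum>i\<in>UNIV. real k * a $ i + z $ i) = 1"
    "\<And>i. \<delta> \<le> real k * a $ i + z $ i"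
    using \<delta>(3)[of a] a by blast
  define c where "c i = real k * a $ i + z $ i" for i
  define x where "x = (\<Sum>i\<in>UNIV. c i *\<^sub>R v i)"
  have c: "\<And>i. \<delta> \<le> c i" "(\<Sum>i\<in>UNIV. c i) = 1" using kz by (simp_all add: c_def)
  have vP: "v i \<in> P" "v i \<in> int_points" for i using v by (auto simp: L_def)
  have "x \<in> P" unfolding x_def
  proof (rule convex_sum[OF _ \<open>convex P\<close>])
    show "0 \<le> c i" for i using c(1)[of i] \<delta>(1) by linarith
  qed (use c vP in auto)
  \<comment> \<open>This makes \<open>x\<close> an integer point although the \<open>c i\<close> may
    be fractional: they differ from \<open>k\<close> times the weights of \<open>x0\<close> by
    integers.\<close>
  have "x = real k *\<^sub>R x0 + (\<Sum>i\<in>UNIV. z $ i *\<^sub>R v i)"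
    by (simp add: x_def c_def scaleR_add_left sum.distrib scaleR_sum_right flip: a(3))
  moreover have "(\<Sum>i\<in>UNIV. z $ i *\<^sub>R v i) \<in> int_points" using z vP by (intro int_points_sum) auto
  ultimately have "x \<in> int_points" using x0(2) by (simp add: int_points_def)
  have "span (range (\<lambda>i. v i - x)) = UNIV" by (rule span_differences_shift[OF a(2,3) span0])
  then obtain h :: "'n \<Rightarrow> real^'n" where h: "\<And>j. h j \<in> range (\<lambda>i. v i - x)" "span (range h) = UNIV"
    using ex_indexed_basis_subset by blast
  define A :: "real^'n^'n" where "A = (\<chi> i j. h j $ i)"
  have col: "column j A = h j" for j by (simp add: A_def column_def vec_eq_iff)
  have "span (columns A) = UNIV"
    using h(2) by (simp add: columns_def col full_SetCompr_eq)
  hence "\<exists>B. A ** B = mat 1"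
    unfolding matrix_right_invertible_span_columns span_vec_eq .
  hence "det A \<noteq> 0"
    by (metis det_I det_mul mult_zero_left zero_neq_one)
  moreover have "column j A \<in> int_points" "x + \<delta> *\<^sub>R column j A \<in> P" "x - \<delta> *\<^sub>R column j A \<in> P" for j
  proof -
    obtain i where i: "h j = v i - x" using h(1)[of j] by blast
    show "column j A \<in> int_points" using vP(2)[of i] \<open>x \<in> int_points\<close> by (simp add: col i int_points_def)
    have "(1 - \<delta>) *\<^sub>R x + \<delta> *\<^sub>R v i \<in> P"
      using \<open>convex P\<close> \<open>x \<in> P\<close> vP(1)[of i] \<delta>(1,2) by (intro convexD) auto
    thus "x + \<delta> *\<^sub>R column j A \<in> P" by (simp add: col i algebra_simps)
    show "x - \<delta> *\<^sub>R column j A \<in> P" unfolding col i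
      by (rule reflected_point_mem[OF \<open>convex P\<close> vP(1) c]) (use \<delta>(1) in \<open>auto simp: x_def\<close>)
  qed
  ultimately show ?thesis
    using ex_body_of_fixed_volume[OF \<open>convex P\<close> \<open>x \<in> P\<close> \<open>x \<in> int_points\<close> \<delta>(1,2), of A] by blast
qed

theorem theorem12:
  "\<exists>\<nu>::nat \<Rightarrow> real. (\<forall>n. 0 < \<nu> n) \<and>
     (\<forall>P::(real^'n) set. integral_polyhedron P \<and> interior P \<inter> int_points \<noteq> {} \<longrightarrow>
        (\<exists>C x. C \<subseteq> P \<and> convex_body C \<and> centrally_symmetric_wrt C x \<and>
               measure lebesgue C = \<nu> CARD('n) \<and> C \<inter> int_points = {x}))"
proof -
  \<comment> \<open>The constant is fixed before \<open>P\<close> is given, so it depends on the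
    dimension only.\<close>
  obtain d where d: "0 < d" "\<And>a :: real^('n + 'n option). (\<forall>i. 0 < a $ i) \<and> (\<Sum>i\<in>UNIV. a $ i) = 1 \<longrightarrow>
    (\<exists>k::nat. \<exists>z. (\<forall>i. z $ i \<in> \<int>) \<and> (\<Sum>i\<in>UNIV. real k * a $ i + z $ i) = 1 \<and>
      (\<forall>i. d \<le> real k * a $ i + z $ i))"
    using uniformly_positive_multiple_subspace[OF subspace_UNIV] by auto
  \<comment> \<open>The cap 1/2 ensures \<open>\<delta> < 1\<close>, which the determinant descent
    requires.\<close>
  define \<delta> where "\<delta> = min d (1/2)"
  have \<delta>: "0 < \<delta>" "\<delta> < 1" "\<delta> \<le> d" using d(1) by (auto simp: \<delta>_def)
  have "\<exists>k::nat. \<exists>z. (\<forall>i. z $ i \<in> \<int>) \<and> (\<Sum>i\<in>UNIV. real k * a $ i + z $ i) = 1 \<and>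
        (\<forall>i. \<delta> \<le> real k * a $ i + z $ i)"
    if "\<forall>i. 0 < a $ i" "(\<Sum>i\<in>UNIV. a $ i) = 1" for a :: "real^('n + 'n option)"
    using d(2)[of a] that \<delta>(3) by (meson order_trans)
  note ex_body = ex_body_in_integral_polyhedron[OF _ _ \<delta>(1,2) this]
  show ?thesis
    \<comment> \<open>The type \<open>'n\<close> fixes the dimension, so only the value at
      \<open>CARD('n)\<close> matters and a constant function provides it.\<close>
    by (rule exI[of _ "\<lambda>_. (\<delta> / real CARD('n)) ^ CARD('n)"]) (use \<delta>(1) ex_body in auto)
qed

end
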